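(* Let $d=1$, $I=(0,1)$, let $0=\lambda_{1/2}<\lambda_{3/2}<\cdots<\lambda_{N+1/2}=1$, $L_\alpha=[\lambda_{\alpha-1/2},\lambda_{\alpha+1/2}]$ and $\gamma_\alpha=\lambda_{\alpha+1/2}-\lambda_{\alpha-1/2}$ for $\alpha=1,\dots,N$. Consider $(H,\tilde u)$ of the form $$H(t,x,\lambda)=\sum_{\alpha=1}^N\mathbb{1}_{\lambda\in L_\alpha}(\lambda)\,H_\alpha(t,x),\qquad \tilde u(t,x,\lambda)=\sum_{\alpha=1}^N\mathbb{1}_{\lambda\in L_\alpha}(\lambda)\,\tilde u_\alpha(t,x).$$ Then $(H,\tilde u)$ is a solution of $$\begin{cases}\partial_tH+\partial_x(H\tilde u)=0,\\ \partial_t\tilde u+\tilde u\,\partial_x\tilde u+g\,\partial_x\int_0^1H\,\mathrm{d}\lambda=-g\,\partial_xz_b,\end{cases}\qquad H(0,x,\lambda)=H_0(x,\lambda),\quad \tilde u(0,x,\lambda)=\tilde u_0(x,\lambda),$$ if and only if $(\boldsymbol{H}_N,\tilde{\boldsymbol{U}}_N)$, with $\boldsymbol{H}_N=(H_1,\dots,H_N)^T$ and $\tilde{\boldsymbol{U}}_N=(\tilde u_1,\dots,\tilde u_N)^T$, is a solution of the multilayer system $$\begin{cases}\partial_tH_\alpha+\partial_x(H_\alpha\tilde u_\alpha)=0,\\ \partial_t\tilde u_\alpha+\tilde u_\alpha\,\partial_x\tilde u_\alpha+g\,\partial_x\sum_{\beta=1}^N\gamma_\beta H_\beta=-g\,\partial_xz_b,\end{cases}\qquad\alpha=1,\dots,N,$$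 with initial data $$H_\alpha(0,x)=\frac1{\gamma_\alpha}\int_{\lambda_{\alpha-1/2}}^{\lambda_{\alpha+1/2}}H(0,x,\lambda)\,\mathrm{d}\lambda,\qquad \tilde u_\alpha(0,x)=\frac1{\gamma_\alpha}\int_{\lambda_{\alpha-1/2}}^{\lambda_{\alpha+1/2}}\tilde u(0,x,\lambda)\,\mathrm{d}\lambda.$$
   Context: $g>0$ is the gravity constant, $z_b(x)$ the bottom topography, $t\in(0,T)$, $x\in\mathbb{R}$, $\lambda\in I$. The functions $H_\alpha,\tilde u_\alpha$ are assumed regular enough (e.g. $C^1$) in $(t,x)$. Since the layers $L_\alpha$ share endpoints, the piecewise constant functions and the equations are understood for almost every $\lambda$ (i.e. $\lambda$ in the interiors of the layers). The initial data $H_0,\tilde u_0$ are themselves constant in $\lambda$ on each layer. *)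

theory Defs
  imports "HOL-Analysis.Analysis"
begin

text \<open>Interfaces are a map \<open>lam :: nat \<Rightarrow> real\<close> with \<open>lam i\<close> standing for
  \<open>\<lambda>\<^bsub>i+1/2\<^esub>\<close>, \<open>i = 0, \<dots>, N\<close>, so that layer \<open>\<alpha> \<in> {1..N}\<close> is \<open>[lam (\<alpha> - 1), lam \<alpha>]\<close>.\<close>

definition layer :: "(nat \<Rightarrow> real) \<Rightarrow> nat \<Rightarrow> real set" where
  "layer lam \<alpha> = {lam (\<alpha> - 1)..lam \<alpha>}"

definition thickness :: "(nat \<Rightarrow> real) \<Rightarrow> nat \<Rightarrow> real" where
  "thickness lam \<alpha> = lam \<alpha> - lam (\<alpha> - 1)"

definition layered ::
  "nat \<Rightarrow> (nat \<Rightarrow> real) \<Rightarrow> (nat \<Rightarrow> real \<Rightarrow> real \<Rightarrow> real) \<Rightarrow> real \<Rightarrow> real \<Rightarrow> real \<Rightarrow> real" where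
  "layered N lam f t x l = (\<Sum>\<alpha> = 1..N. indicat_real (layer lam \<alpha>) l * f \<alpha> t x)"

text \<open>Meant for open \<open>S\<close>: the derivative is the unrestricted one.\<close>

definition C1_on :: "'a::real_normed_vector set \<Rightarrow> ('a \<Rightarrow> 'b::real_normed_vector) \<Rightarrow> bool" where
  "C1_on S f \<longleftrightarrow>
     (\<exists>f'. continuous_on S f' \<and> (\<forall>p\<in>S. (f has_derivative blinfun_apply (f' p)) (at p)))"

text \<open>Both notions of solution below are classical in \<open>(t, x)\<close>: every derivative occurring in an
  equation is required to exist.\<close>

text \<open>Functions take their arguments in the order \<open>t\<close>, \<open>x\<close>, \<open>\<lambda>\<close>; equations and initial
  conditions hold for almost every \<open>\<lambda> \<in> I = (0,1)\<close>.\<close>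

definition solves_continuous ::
  "real \<Rightarrow> (real \<Rightarrow> real) \<Rightarrow> real \<Rightarrow> (real \<Rightarrow> real \<Rightarrow> real) \<Rightarrow> (real \<Rightarrow> real \<Rightarrow> real) \<Rightarrow>
   (real \<Rightarrow> real \<Rightarrow> real \<Rightarrow> real) \<Rightarrow> (real \<Rightarrow> real \<Rightarrow> real \<Rightarrow> real) \<Rightarrow> bool" where
  "solves_continuous g zb T H0 u0 H u \<longleftrightarrow>
     (\<forall>t\<in>{0<..<T}. \<forall>x. set_integrable lborel {0<..<1} (H t x)) \<and>
     (AE l in lborel. l \<in> {0<..<1} \<longrightarrow>
        (\<forall>t\<in>{0<..<T}. \<forall>x.
           (\<exists>Ht Fx.
              ((\<lambda>s. H s x l) has_real_derivative Ht) (at t) \<and>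
              ((\<lambda>y. H t y l * u t y l) has_real_derivative Fx) (at x) \<and>
              Ht + Fx = 0) \<and>
           (\<exists>ut ux px zx.
              ((\<lambda>s. u s x l) has_real_derivative ut) (at t) \<and>
              ((\<lambda>y. u t y l) has_real_derivative ux) (at x) \<and>
              ((\<lambda>y. LBINT k:{0<..<1}. H t y k) has_real_derivative px) (at x) \<and>
              (zb has_real_derivative zx) (at x) \<and>
              ut + u t x l * ux + g * px = - g * zx))) \<and>
     (AE l in lborel. l \<in> {0<..<1} \<longrightarrow> (\<forall>x. H 0 x l = H0 x l \<and> u 0 x l = u0 x l))"

text \<open>The initial values of the layers are the layer averages of the data \<open>H0\<close>, \<open>u0\<close>
  prescribed for the \<open>\<lambda>\<close>-dependent problem.\<close>

definition solves_multilayer ::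
  "real \<Rightarrow> (real \<Rightarrow> real) \<Rightarrow> real \<Rightarrow> nat \<Rightarrow> (nat \<Rightarrow> real) \<Rightarrow>
   (real \<Rightarrow> real \<Rightarrow> real) \<Rightarrow> (real \<Rightarrow> real \<Rightarrow> real) \<Rightarrow>
   (nat \<Rightarrow> real \<Rightarrow> real \<Rightarrow> real) \<Rightarrow> (nat \<Rightarrow> real \<Rightarrow> real \<Rightarrow> real) \<Rightarrow> bool" where
  "solves_multilayer g zb T N lam H0 u0 Hl ul \<longleftrightarrow>
     (\<forall>\<alpha>\<in>{1..N}.
        (\<forall>t\<in>{0<..<T}. \<forall>x.
           (\<exists>Ht Fx.
              ((\<lambda>s. Hl \<alpha> s x) has_real_derivative Ht) (at t) \<and>
              ((\<lambda>y. Hl \<alpha> t y * ul \<alpha> t y) has_real_derivative Fx) (at x) \<and>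
              Ht + Fx = 0) \<and>
           (\<exists>ut ux px zx.
              ((\<lambda>s. ul \<alpha> s x) has_real_derivative ut) (at t) \<and>
              ((\<lambda>y. ul \<alpha> t y) has_real_derivative ux) (at x) \<and>
              ((\<lambda>y. \<Sum>\<beta> = 1..N. thickness lam \<beta> * Hl \<beta> t y) has_real_derivative px) (at x) \<and>
              (zb has_real_derivative zx) (at x) \<and>
              ut + ul \<alpha> t x * ux + g * px = - g * zx)) \<and>
        (\<forall>x. Hl \<alpha> 0 x = 1 / thickness lam \<alpha> * (LBINT l:layer lam \<alpha>. H0 x l) \<and>
             ul \<alpha> 0 x = 1 / thickness lam \<alpha> * (LBINT l:layer lam \<alpha>. u0 x l)))"

end

theory Submission
  imports Defs
begin

text \<open>Off the finitely many interfaces, the layer interiors partition \<open>(0,1)\<close>, and on the interior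
  of a layer all data are constant in \<open>\<lambda>\<close>. As each interior has positive measure, an almost
  everywhere statement in \<open>\<lambda>\<close> amounts to one statement per layer; the integral becomes the
  weighted sum and the constant value of the initial data on a layer is its average.\<close>

locale layering =
  fixes N :: nat and lam :: "nat \<Rightarrow> real"
  assumes lam_0: "lam 0 = 0" and lam_N: "lam N = 1"
    and strict_mono_lam: "strict_mono_on {0..N} lam"
begin

lemma lam_less: "i < j \<Longrightarrow> j \<le> N \<Longrightarrow> lam i < lam j"
  using strict_mono_lam by (auto simp: strict_mono_on_def)

lemma lam_le: "i \<le> j \<Longrightarrow> j \<le> N \<Longrightarrow> lam i \<le> lam j"
  using lam_less[of i j] by (cases "i = j") auto

lemma thickness_pos: "\<alpha> \<in> {1..N} \<Longrightarrow> 0 < thickness lam \<alpha>"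
  using lam_less[of "\<alpha> - 1" \<alpha>] by (auto simp: thickness_def)

lemma interior_layer: "interior (layer lam \<alpha>) = {lam (\<alpha> - 1)<..<lam \<alpha>}"
  by (simp add: layer_def)

lemma lam_bounds: "\<alpha> \<in> {1..N} \<Longrightarrow> 0 \<le> lam (\<alpha> - 1) \<and> lam \<alpha> \<le> 1"
  using lam_le[of 0 "\<alpha> - 1"] lam_le[of \<alpha> N] lam_0 lam_N by (auto simp: le_diff_conv)

lemma layer_subset: "\<alpha> \<in> {1..N} \<Longrightarrow> layer lam \<alpha> \<subseteq> {0..1}"
  using lam_bounds by (fastforce simp: layer_def)

lemma interior_layer_subset: "\<alpha> \<in> {1..N} \<Longrightarrow> interior (layer lam \<alpha>) \<subseteq> {0<..<1}"
  using lam_bounds by (fastforce simp: interior_layer)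

text \<open>Layers are closed and share endpoints, so only a point interior to one of them is sure
  to avoid the others. Distinct layers are separated by monotonicity of \<open>lam\<close> between
  the right end of one and the left end of the other.\<close>

lemma interior_layer_disjoint:
  assumes "\<alpha> \<in> {1..N}" "\<beta> \<in> {1..N}" "l \<in> interior (layer lam \<alpha>)" "l \<in> layer lam \<beta>"
  shows "\<beta> = \<alpha>"
proof (rule linorder_cases[of \<alpha> \<beta>])
  assume "\<alpha> < \<beta>"
  then have "lam \<alpha> \<le> lam (\<beta> - 1)"
    using assms by (intro lam_le) auto
  then show ?thesis
    using assms by (auto simp: interior_layer layer_def)
next
  assume "\<beta> < \<alpha>"
  then have "lam \<beta> \<le> lam (\<alpha> - 1)"
    using assms by (intro lam_le) auto
  then show ?thesis
    using assms by (auto simp: interior_layer layer_def)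
qed simp

text \<open>Only one indicator survives in the sum. At an interface between two layers this fails:
  both neighbouring terms are counted there.\<close>

lemma layered_interior:
  assumes "\<alpha> \<in> {1..N}" "l \<in> interior (layer lam \<alpha>)"
  shows "layered N lam f t x l = f \<alpha> t x"
proof -
  have "indicat_real (layer lam \<beta>) l = (if \<beta> = \<alpha> then 1 else 0)" if "\<beta> \<in> {1..N}" for \<beta>
    using interior_layer_disjoint[OF assms(1) that assms(2)] assms(2) interior_subset
    by (auto simp: indicator_def)
  then have "layered N lam f t x l = (\<Sum>\<beta> = 1..N. if \<beta> = \<alpha> then f \<beta> t x else 0)"
    unfolding layered_def by (intro sum.cong) auto
  also have "\<dots> = f \<alpha> t x"
    using assms(1) by (simp add: sum.delta)
  finally show ?thesis .
qed

lemma ex_interior_layer: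
  assumes "l \<in> {0<..<1}" "l \<notin> lam ` {0..N}"
  obtains \<alpha> where "\<alpha> \<in> {1..N}" "l \<in> interior (layer lam \<alpha>)"
proof -
  \<comment> \<open>The first interface to the right of \<open>l\<close> is the upper end of the
    layer sought; minimality bounds \<open>l\<close> from below by the preceding interface, strictly
    since \<open>l\<close> is no interface.\<close>
  define \<alpha> where "\<alpha> = (LEAST i. l < lam i)"
  have *: "l < lam N" using assms(1) lam_N by simp
  have 1: "l < lam \<alpha>" and 2: "\<alpha> \<le> N"
    unfolding \<alpha>_def using * by (auto intro: LeastI Least_le)
  \<comment> \<open>Needed because \<open>0 - 1 = 0\<close> on naturals: only now is
    \<open>\<alpha> - 1\<close> a genuine predecessor.\<close>
  have 3: "\<alpha> \<noteq> 0" using 1 assms(1) lam_0 by (metis greaterThanLessThan_iff less_asym)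
  have "\<not> l < lam (\<alpha> - 1)"
    using not_less_Least[of "\<alpha> - 1" "\<lambda>i. l < lam i"] 3 by (simp add: \<alpha>_def[symmetric])
  moreover have "l \<noteq> lam (\<alpha> - 1)" using assms(2) 2 by auto
  ultimately show ?thesis
    using that[of \<alpha>] 1 2 3 by (auto simp: interior_layer)
qed

text \<open>Serves both the equations and the initial data. The quantifiers over time and space sit
  inside \<open>P\<close>, so a single null set of \<open>l\<close> is excluded for all of
  them.\<close>

lemma AE_layers_iff:
  assumes eq: "\<And>\<alpha> l. \<alpha> \<in> {1..N} \<Longrightarrow> l \<in> interior (layer lam \<alpha>) \<Longrightarrow> P l \<longleftrightarrow> Q \<alpha>"
  shows "(AE l in lborel. l \<in> {0<..<1} \<longrightarrow> P l) \<longleftrightarrow> (\<forall>\<alpha>\<in>{1..N}. Q \<alpha>)"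
proof
  assume AE: "AE l in lborel. l \<in> {0<..<1} \<longrightarrow> P l"
  show "\<forall>\<alpha>\<in>{1..N}. Q \<alpha>"
  proof (rule ballI, rule ccontr)
    fix \<alpha> assume \<alpha>: "\<alpha> \<in> {1..N}" and "\<not> Q \<alpha>"
    \<comment> \<open>If \<open>Q \<alpha>\<close> fails, \<open>P\<close> fails throughout this
      interior, which must then be null although its length is
      \<open>thickness lam \<alpha>\<close>.\<close>
    with AE have "AE l in lborel. l \<notin> interior (layer lam \<alpha>)"
      using eq interior_layer_subset[OF \<alpha>] by (auto elim!: eventually_mono)
    then have "emeasure lborel (interior (layer lam \<alpha>)) = 0"
      by (subst (asm) AE_iff_measurable[of "interior (layer lam \<alpha>)"]) (auto simp: interior_layer)
    then show False
      using thickness_pos[OF \<alpha>] by (simp add: interior_layer thickness_def split: if_splits)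
  qed
next
  assume Q: "\<forall>\<alpha>\<in>{1..N}. Q \<alpha>"
  have "AE l in lborel. l \<notin> lam ` {0..N}"
    by (rule AE_not_in) (simp add: finite_imp_null_set_lborel)
  then show "AE l in lborel. l \<in> {0<..<1} \<longrightarrow> P l"
    by (rule eventually_mono) (metis Q eq ex_interior_layer)
qed

lemma has_bochner_integral_layered:
  "has_bochner_integral lborel (layered N lam f t x) (\<Sum>\<alpha> = 1..N. thickness lam \<alpha> * f \<alpha> t x)"
  unfolding layered_def
proof (intro has_bochner_integral_sum has_bochner_integral_mult_left)
  fix \<alpha> assume "\<alpha> \<in> {1..N}"
  then show "has_bochner_integral lborel (indicat_real (layer lam \<alpha>)) (thickness lam \<alpha>)"
    using has_bochner_integral_real_indicator[of "layer lam \<alpha>" lborel] thickness_pos[of \<alpha>]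
    by (simp add: layer_def thickness_def)
qed

text \<open>The closed layers stay within the closed unit interval, so cutting off to the open one
  changes the integrand at most at the points 0 and 1.\<close>

lemma has_bochner_integral_layered_01:
  "has_bochner_integral lborel (\<lambda>l. indicat_real {0<..<1} l *\<^sub>R layered N lam f t x l)
     (\<Sum>\<alpha> = 1..N. thickness lam \<alpha> * f \<alpha> t x)"
proof (rule has_bochner_integralI_AE[OF has_bochner_integral_layered])
  have "AE l in lborel. l \<notin> {0, 1 :: real}"
    by (rule AE_not_in) (simp add: finite_imp_null_set_lborel)
  then show "AE l in lborel.
      layered N lam f t x l = indicat_real {0<..<1} l *\<^sub>R layered N lam f t x l"
  proof (rule eventually_mono)
    fix l :: real assume l: "l \<notin> {0, 1}"
    have "layered N lam f t x l = 0" if "l \<notin> {0<..<1}"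
      unfolding layered_def using layer_subset that l
      by (intro sum.neutral) (fastforce simp: indicator_def)
    then show "layered N lam f t x l = indicat_real {0<..<1} l *\<^sub>R layered N lam f t x l"
      by (auto simp: indicator_def)
  qed
  have "layered N lam f t x \<in> borel_measurable borel"
    using borel_measurable_has_bochner_integral[OF has_bochner_integral_layered] by simp
  then show "(\<lambda>l. indicat_real {0<..<1} l *\<^sub>R layered N lam f t x l) \<in> borel_measurable lborel"
    by simp
qed

lemma set_integrable_layered: "set_integrable lborel {0<..<1} (layered N lam f t x)"
  unfolding set_integrable_def using has_bochner_integral_layered_01 by (rule integrable.intros)

lemma integral_layered:
  "(LBINT l:{0<..<1}. layered N lam f t x l) = (\<Sum>\<alpha> = 1..N. thickness lam \<alpha> * f \<alpha> t x)"
  unfolding set_lebesgue_integral_def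
  using has_bochner_integral_layered_01 by (rule has_bochner_integral_integral_eq)

text \<open>Turns an averaged initial value back into a pointwise one.\<close>

lemma layer_average:
  assumes \<alpha>: "\<alpha> \<in> {1..N}" and const: "h constant_on interior (layer lam \<alpha>)"
    and l: "l \<in> interior (layer lam \<alpha>)"
  shows "1 / thickness lam \<alpha> * (LBINT k:layer lam \<alpha>. h k) = h l"
proof -
  have h: "h k = h l" if "k \<in> interior (layer lam \<alpha>)" for k
    using const l that unfolding constant_on_def by metis
  have lt: "lam (\<alpha> - 1) < lam \<alpha>" using thickness_pos[OF \<alpha>] by (simp add: thickness_def)
  \<comment> \<open>The interval integral ignores the endpoints, where nothing is known about
    \<open>h\<close>; its congruence rule asks for agreement on the open interval only.\<close>
  have "(LBINT k:layer lam \<alpha>. h k) = (LBINT k=lam (\<alpha> - 1)..lam \<alpha>. h k)"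
    using lt by (simp add: interval_integral_Icc layer_def)
  also have "\<dots> = (LBINT k=lam (\<alpha> - 1)..lam \<alpha>. h l)"
    using lt h by (intro interval_integral_cong) (auto simp: interior_layer einterval_eq)
  also have "\<dots> = thickness lam \<alpha> * h l"
    using lt by (simp add: interval_integral_const thickness_def)
  finally show ?thesis using thickness_pos[OF \<alpha>] by simp
qed

end

theorem corollary5p2:
  fixes g T :: real and z_b :: "real \<Rightarrow> real"
    and N :: nat and lam :: "nat \<Rightarrow> real"
    and Hl ul :: "nat \<Rightarrow> real \<Rightarrow> real \<Rightarrow> real"
    and H0 u0 :: "real \<Rightarrow> real \<Rightarrow> real"
  assumes "g > 0" and "T > 0"
    and "lam 0 = 0" and "lam N = 1" and "strict_mono_on {0..N} lam"
    and "\<And>\<alpha>. \<alpha> \<in> {1..N} \<Longrightarrow> C1_on ({0<..<T} \<times> UNIV) (\<lambda>(t, x). Hl \<alpha> t x)"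
    and "\<And>\<alpha>. \<alpha> \<in> {1..N} \<Longrightarrow> C1_on ({0<..<T} \<times> UNIV) (\<lambda>(t, x). ul \<alpha> t x)"
    and "\<And>\<alpha>. \<alpha> \<in> {1..N} \<Longrightarrow> continuous_on ({0..<T} \<times> UNIV) (\<lambda>(t, x). Hl \<alpha> t x)"
    and "\<And>\<alpha>. \<alpha> \<in> {1..N} \<Longrightarrow> continuous_on ({0..<T} \<times> UNIV) (\<lambda>(t, x). ul \<alpha> t x)"
    and "\<And>\<alpha> x. \<alpha> \<in> {1..N} \<Longrightarrow> H0 x constant_on interior (layer lam \<alpha>)"
    and "\<And>\<alpha> x. \<alpha> \<in> {1..N} \<Longrightarrow> u0 x constant_on interior (layer lam \<alpha>)"
  shows "solves_continuous g z_b T H0 u0 (layered N lam Hl) (layered N lam ul)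
     \<longleftrightarrow> solves_multilayer g z_b T N lam H0 u0 Hl ul"
proof -
  interpret layering N lam
    by unfold_locales (use assms in auto)
  have initial: "(AE l in lborel. l \<in> {0<..<1} \<longrightarrow>
      (\<forall>x. layered N lam Hl 0 x l = H0 x l \<and> layered N lam ul 0 x l = u0 x l)) \<longleftrightarrow>
    (\<forall>\<alpha>\<in>{1..N}. \<forall>x. Hl \<alpha> 0 x = 1 / thickness lam \<alpha> * (LBINT l:layer lam \<alpha>. H0 x l) \<and>
             ul \<alpha> 0 x = 1 / thickness lam \<alpha> * (LBINT l:layer lam \<alpha>. u0 x l))"
  proof (rule AE_layers_iff, goal_cases)
    case (1 \<alpha> l)
    then show ?case
      by (simp only: layered_interior[OF 1] layer_average[OF 1(1) assms(10)[OF 1(1)] 1(2)]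
          layer_average[OF 1(1) assms(11)[OF 1(1)] 1(2)])
  qed
  have integrable:
    "\<forall>t\<in>{0<..<T}. \<forall>x. set_integrable lborel {0<..<1} (layered N lam Hl t x)"
    using set_integrable_layered by blast
  \<comment> \<open>Integrability holds for every layered function and becomes \<open>True\<close>.
    The multilayer side is split into equations and initial data; the latter then agree literally on
    both sides, leaving \<open>refl\<close>. The pressure integral does not involve
    \<open>l\<close>, so it is replaced by the weighted sum beforehand.\<close>
  show ?thesis
    unfolding solves_continuous_def solves_multilayer_def ball_conj_distrib[of "{1..N}"]
      initial integral_layered eqTrueI[OF integrable] simp_thms
  proof (rule arg_cong2[where f = "(\<and>)", OF AE_layers_iff refl], goal_cases)
    case (1 \<alpha> l)
    \<comment> \<open>For this fixed \<open>l\<close>, the layered functions equal those of layer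
      \<alpha> at every time and place, so the functions being differentiated are identical and the
      derivative conditions coincide.\<close>
    then show ?case
      by (simp only: layered_interior[OF 1])
  qed
qed

end
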